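(* Let $K$ be a field, let $I \subset R=K[x,y,z]$ be a monomial ideal, $\mathfrak{m}=(x,y,z)$, and $$\mathcal{G}(I)=\{x^{r_{1,1}} y^{r_{1,2}} z^{r_{1,3}}, \ldots, x^{r_{k,1}} y^{r_{k,2}} z^{r_{k,3}}\}$$ such that $$r_{1,i} \geq r_{2,i} \geq \cdots \geq r_{k, i} \quad\text{and}\quad r_{1,j} \geq r_{2,j} \geq \cdots \geq r_{k, j}$$ for some $1\leq i\neq j \leq 3$. Then $\mathfrak{m}\notin \mathrm{Ass}(R/I)$, that is, $\mathrm{C}_R(I)=\emptyset$.
   Context: $\mathcal{G}(I)$ denotes the unique minimal set of monomial generators of a monomial ideal $I$. $\mathrm{Ass}(R/I)$ is the set of associated primes of $I$, i.e. primes of the form $(I:v)$ with $v\in R$. A monomial $f\in R$ is an $I$-corner element if $f\notin I$ and $xf,yf,zf\in I$; $\mathrm{C}_R(I)$ is the set of $I$-corner elements. *)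

theory Defs
  imports Complex_Main "HOL-Library.Poly_Mapping"
begin

datatype indet = X | Y | Z

text \<open>
  The ring \<open>K[x,y,z]\<close>: exponent vectors are finitely supported functions on the three
  indeterminates, polynomials are finitely supported functions from exponent vectors to
  \<open>K\<close>, and multiplication is the convolution product of \<^theory>\<open>HOL-Library.Poly_Mapping\<close>.
\<close>

type_synonym 'k poly3 = "(indet \<Rightarrow>\<^sub>0 nat) \<Rightarrow>\<^sub>0 'k"

definition var :: "indet \<Rightarrow> 'k::field poly3" where
  "var v = Poly_Mapping.single (Poly_Mapping.single v 1) 1"

definition monom :: "(indet \<Rightarrow> nat) \<Rightarrow> 'k::field poly3" where
  "monom e = var X ^ e X * var Y ^ e Y * var Z ^ e Z"

definition monomials :: "'k::field poly3 set" where
  "monomials = range monom"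

text \<open>Ideals of a commutative ring are the submodules of the ring viewed as a module over itself.\<close>

lemma module_times: "module ((*) :: 'a::comm_ring_1 \<Rightarrow> 'a \<Rightarrow> 'a)"
  by unfold_locales (simp_all add: algebra_simps)

definition is_ideal :: "'a::comm_ring_1 set \<Rightarrow> bool" where
  "is_ideal I \<longleftrightarrow> module.subspace (*) I"

definition ideal :: "'a::comm_ring_1 set \<Rightarrow> 'a set" where
  "ideal S = module.span (*) S"

definition prime_ideal :: "'a::comm_ring_1 set \<Rightarrow> bool" where
  "prime_ideal P \<longleftrightarrow>
     is_ideal P \<and> P \<noteq> UNIV \<and> (\<forall>a b. a * b \<in> P \<longrightarrow> a \<in> P \<or> b \<in> P)"

definition colon :: "'a::comm_ring_1 set \<Rightarrow> 'a \<Rightarrow> 'a set" where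
  "colon I v = {f. f * v \<in> I}"

text \<open>\<open>Ass I\<close> is the set written \<open>Ass(R/I)\<close>.\<close>

definition Ass :: "'a::comm_ring_1 set \<Rightarrow> 'a set set" where
  "Ass I = {P. prime_ideal P \<and> (\<exists>v. P = colon I v)}"

definition monomial_ideal :: "'k::field poly3 set \<Rightarrow> bool" where
  "monomial_ideal I \<longleftrightarrow> (\<exists>S \<subseteq> monomials. I = ideal S)"

text \<open>
  \<open>min_monomial_gens I G\<close> states \<open>G = \<G>(I)\<close>: \<open>G\<close> is a set of monomials generating \<open>I\<close>, and no
  proper subset of it generates \<open>I\<close>. A monomial ideal has exactly one such set; using a
  relation avoids building this uniqueness into the definition.
\<close>

definition min_monomial_gens :: "'k::field poly3 set \<Rightarrow> 'k poly3 set \<Rightarrow> bool" where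
  "min_monomial_gens I G \<longleftrightarrow>
     G \<subseteq> monomials \<and> ideal G = I \<and> (\<forall>H. H \<subset> G \<longrightarrow> ideal H \<noteq> I)"

definition max_ideal :: "'k::field poly3 set" where
  "max_ideal = ideal {var X, var Y, var Z}"

definition corner_elements :: "'k::field poly3 set \<Rightarrow> 'k poly3 set" where
  "corner_elements I =
     {f \<in> monomials. f \<notin> I \<and> var X * f \<in> I \<and> var Y * f \<in> I \<and> var Z * f \<in> I}"

end

theory Submission
  imports Defs
begin

text \<open>
  Membership in a monomial ideal is decided term by term: a polynomial lies in the ideal
  generated by a set of monomials iff each of its exponent vectors is divisible by (pointwise
  at least) the exponent vector of some generator (\<open>mem_ideal_monom_iff\<close>).

  Suppose \<open>v \<notin> I\<close>, but both \<open>x\<^sub>i v\<close> and \<open>x\<^sub>j v\<close> lie in \<open>I\<close>. Some term \<open>t\<close> of \<open>v\<close> is not in \<open>I\<close>,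
  whereas \<open>x\<^sub>i t\<close> and \<open>x\<^sub>j t\<close> are. A generator \<open>p\<close> dividing \<open>x\<^sub>i t\<close> but not \<open>t\<close> has \<open>i\<close>-exponent
  exactly one above that of \<open>t\<close> and all its other exponents at most those of \<open>t\<close>; likewise, a
  generator \<open>q\<close> dividing \<open>x\<^sub>j t\<close> but not \<open>t\<close> exceeds \<open>t\<close> only in the exponent of \<open>x\<^sub>j\<close>. Hence
  \<open>p\<close> has the strictly larger \<open>i\<close>-exponent and \<open>q\<close> the strictly larger \<open>j\<close>-exponent, which is
  impossible when the two exponents decrease together along the list of generators. So
  \<open>(I : (x\<^sub>i, x\<^sub>j)) = I\<close> (\<open>mem_ideal_of_var_mults\<close>). A corner element would contradict this
  equality, and so would an element \<open>v\<close> with \<open>(I : v) = \<mm>\<close>.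
\<close>

interpretation ring_module: module "(*) :: 'a::comm_ring_1 \<Rightarrow> 'a \<Rightarrow> 'a"
  by (rule module_times)

definition exponent :: "(indet \<Rightarrow> nat) \<Rightarrow> indet \<Rightarrow>\<^sub>0 nat" where
  "exponent e = Poly_Mapping.single X (e X) + Poly_Mapping.single Y (e Y)
     + Poly_Mapping.single Z (e Z)"

lemma lookup_exponent [simp]: "Poly_Mapping.lookup (exponent e) l = e l"
  by (cases l) (simp_all add: exponent_def lookup_add lookup_single)

lemma var_power: "(var l :: 'k::field poly3) ^ n = Poly_Mapping.single (Poly_Mapping.single l n) 1"
  by (induction n) (simp_all add: var_def mult_single flip: single_add)

lemma monom_eq_single: "(monom e :: 'k::field poly3) = Poly_Mapping.single (exponent e) 1"
  by (simp add: monom_def var_power mult_single exponent_def)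

lemma sum_terms:
  "(\<Sum>t \<in> Poly_Mapping.keys f. Poly_Mapping.single t (Poly_Mapping.lookup f t)) = f"
  by (rule poly_mapping_eqI)
    (auto simp: lookup_sum lookup_single when_def not_in_keys_iff_lookup_eq_zero)

text \<open>
  From left to right, the polynomials all of whose terms are divisible by a generator form an
  ideal containing the generators. From right to left, a polynomial is the sum of its terms,
  and a term divisible by a generator is a multiple of it.
\<close>

lemma mem_ideal_monom_iff:
  fixes f :: "'k::field poly3"
  shows "f \<in> ideal (monom ` A) \<longleftrightarrow>
    (\<forall>t \<in> Poly_Mapping.keys f. \<exists>a \<in> A. \<forall>l. a l \<le> Poly_Mapping.lookup t l)"
    (is "_ \<longleftrightarrow> ?D f")
proof
  have "ring_module.subspace {f :: 'k poly3. ?D f}"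
  proof (rule ring_module.subspaceI)
    show "f + g \<in> {f. ?D f}" if "f \<in> {f. ?D f}" "g \<in> {f. ?D f}" for f g :: "'k poly3"
      using that Poly_Mapping.keys_add[of f g] by blast
    show "c * f \<in> {f. ?D f}" if f: "f \<in> {f. ?D f}" for c f :: "'k poly3"
    proof (clarify)
      fix t assume "t \<in> Poly_Mapping.keys (c * f)"
      then obtain s u where "t = s + u" "u \<in> Poly_Mapping.keys f"
        using keys_mult[of c f] by auto
      moreover from this f obtain a where "a \<in> A" "\<forall>l. a l \<le> Poly_Mapping.lookup u l"
        by auto
      ultimately show "\<exists>a \<in> A. \<forall>l. a l \<le> Poly_Mapping.lookup t l"
        by (metis lookup_add trans_le_add2)
    qed
  qed simp
  moreover have "monom ` A \<subseteq> {f :: 'k poly3. ?D f}"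
    by (auto simp: monom_eq_single)
  ultimately show "?D f" if "f \<in> ideal (monom ` A)"
    using that ring_module.span_minimal unfolding ideal_def by blast
next
  assume D: "?D f"
  have "Poly_Mapping.single t (Poly_Mapping.lookup f t) \<in> ideal (monom ` A)"
    if "t \<in> Poly_Mapping.keys f" for t
  proof -
    obtain a where a: "a \<in> A" "\<forall>l. a l \<le> Poly_Mapping.lookup t l"
      using D \<open>t \<in> Poly_Mapping.keys f\<close> by blast
    have "t = (t - exponent a) + exponent a"
      using a(2) by (intro poly_mapping_eqI) (simp add: lookup_add lookup_minus)
    then have "Poly_Mapping.single t (Poly_Mapping.lookup f t)
        = Poly_Mapping.single (t - exponent a) (Poly_Mapping.lookup f t) * monom a"
      by (simp add: monom_eq_single mult_single)
    then show ?thesis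
      using a(1) unfolding ideal_def by (auto intro: ring_module.span_scale ring_module.span_base)
  qed
  then have "(\<Sum>t \<in> Poly_Mapping.keys f. Poly_Mapping.single t (Poly_Mapping.lookup f t))
      \<in> ideal (monom ` A)"
    unfolding ideal_def by (rule ring_module.span_sum)
  then show "f \<in> ideal (monom ` A)"
    by (simp add: sum_terms)
qed

lemma lookup_var_mult:
  fixes f :: "'k::field poly3"
  shows "Poly_Mapping.lookup (var l * f) (Poly_Mapping.single l 1 + t) = Poly_Mapping.lookup f t"
  by (simp add: var_def lookup_mult lookup_single when_mult)

lemma keys_var_mult:
  fixes f :: "'k::field poly3"
  assumes "t \<in> Poly_Mapping.keys f"
  shows "Poly_Mapping.single l 1 + t \<in> Poly_Mapping.keys (var l * f)"
  using assms by (metis in_keys_iff lookup_var_mult)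

text \<open>
  The terms \<open>x\<^sub>l t\<close> and \<open>t\<close> differ only in the exponent of \<open>x\<^sub>l\<close>, so this exponent alone can
  prevent a divisor \<open>a\<close> of \<open>x\<^sub>l t\<close> from dividing \<open>t\<close>.
\<close>

lemma exceeds_only_at:
  fixes a :: "'a \<Rightarrow> nat" and t :: "'a \<Rightarrow>\<^sub>0 nat"
  assumes "\<forall>l'. a l' \<le> Poly_Mapping.lookup (Poly_Mapping.single l 1 + t) l'"
    and "\<not> (\<forall>l'. a l' \<le> Poly_Mapping.lookup t l')"
  shows "Poly_Mapping.lookup t l < a l" and "l' \<noteq> l \<Longrightarrow> a l' \<le> Poly_Mapping.lookup t l'"
proof -
  have *: "a l' \<le> Poly_Mapping.lookup t l'" if "l' \<noteq> l" for l'
    using assms(1)[rule_format, of l'] that by (simp add: lookup_add lookup_single)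
  then show "l' \<noteq> l \<Longrightarrow> a l' \<le> Poly_Mapping.lookup t l'" .
  show "Poly_Mapping.lookup t l < a l"
    using assms(2) * by (metis not_le)
qed

text \<open>
  The ordering of the generators enters only through pairs of them, as the hypothesis that the
  exponents at \<open>i\<close> and \<open>j\<close> never order two generators strictly in opposite directions. The
  generators dividing \<open>x\<^sub>i t\<close> and \<open>x\<^sub>j t\<close>, for a term \<open>t\<close> of \<open>v\<close> outside the ideal, would be
  such a pair.
\<close>

lemma mem_ideal_of_var_mults:
  fixes v :: "'k::field poly3"
  assumes "i \<noteq> j"
    and no_crossing: "\<And>a b. a \<in> A \<Longrightarrow> b \<in> A \<Longrightarrow> b i < a i \<Longrightarrow> b j \<le> a j"
    and vi: "var i * v \<in> ideal (monom ` A)" and vj: "var j * v \<in> ideal (monom ` A)"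
  shows "v \<in> ideal (monom ` A)"
proof (rule ccontr)
  assume "v \<notin> ideal (monom ` A)"
  then obtain t where t: "t \<in> Poly_Mapping.keys v"
    and nt: "\<And>a. a \<in> A \<Longrightarrow> \<not> (\<forall>l. a l \<le> Poly_Mapping.lookup t l)"
    by (auto simp: mem_ideal_monom_iff)
  obtain a where a: "a \<in> A" "\<forall>l. a l \<le> Poly_Mapping.lookup (Poly_Mapping.single i 1 + t) l"
    using vi keys_var_mult[OF t] unfolding mem_ideal_monom_iff by blast
  obtain b where b: "b \<in> A" "\<forall>l. b l \<le> Poly_Mapping.lookup (Poly_Mapping.single j 1 + t) l"
    using vj keys_var_mult[OF t] unfolding mem_ideal_monom_iff by blast
  note a_exceeds = exceeds_only_at[OF a(2) nt[OF a(1)]]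
  note b_exceeds = exceeds_only_at[OF b(2) nt[OF b(1)]]
  have "b i < a i"
    using a_exceeds(1) b_exceeds(2)[OF \<open>i \<noteq> j\<close>] by simp
  moreover have "a j < b j"
    using b_exceeds(1) a_exceeds(2)[OF \<open>i \<noteq> j\<close>[symmetric]] by simp
  ultimately show False
    using no_crossing[OF a(1) b(1)] by simp
qed

theorem proposition3p4:
  fixes I :: "'k::field poly3 set"
    and r :: "nat \<Rightarrow> indet \<Rightarrow> nat"
    and k :: nat
    and i j :: indet
  assumes "monomial_ideal I"
    and "min_monomial_gens I ((\<lambda>p. monom (r p)) ` {1..k})"
    and "i \<noteq> j"
    and "\<And>p q. 1 \<le> p \<Longrightarrow> p \<le> q \<Longrightarrow> q \<le> k \<Longrightarrow> r q i \<le> r p i"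
    and "\<And>p q. 1 \<le> p \<Longrightarrow> p \<le> q \<Longrightarrow> q \<le> k \<Longrightarrow> r q j \<le> r p j"
  shows "max_ideal \<notin> Ass I \<and> corner_elements I = {}"
proof -
  have I: "I = ideal (monom ` r ` {1..k})"
    using assms(2) by (simp add: min_monomial_gens_def image_image)
  have no_crossing: "b j \<le> a j" if ab: "a \<in> r ` {1..k}" "b \<in> r ` {1..k}" "b i < a i" for a b
  proof -
    obtain p q where p: "p \<in> {1..k}" "a = r p" and q: "q \<in> {1..k}" "b = r q"
      using ab(1,2) by blast
    have "p \<le> q"
      using assms(4)[of q p] p q ab(3) by (cases "p \<le> q") auto
    then show ?thesis
      using assms(5)[of p q] p q by simp
  qed
  have mem_I_of_var_mults: "v \<in> I" if "\<And>l. var l * v \<in> I" for v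
    unfolding I
    by (rule mem_ideal_of_var_mults[where i = i and j = j, OF assms(3)])
      (rule no_crossing, assumption+, use that I in simp_all)
  have "corner_elements I = {}"
  proof (rule equals0I)
    fix f assume f: "f \<in> corner_elements I"
    then have "var l * f \<in> I" for l
      by (cases l) (auto simp: corner_elements_def)
    then have "f \<in> I"
      by (rule mem_I_of_var_mults)
    with f show False
      by (simp add: corner_elements_def)
  qed
  moreover have "max_ideal \<notin> Ass I"
  proof
    assume "max_ideal \<in> Ass I"
    then obtain v where v: "max_ideal = colon I v" and proper: "colon I v \<noteq> UNIV"
      by (auto simp: Ass_def prime_ideal_def)
    have "var l \<in> (max_ideal :: 'k poly3 set)" for l
      unfolding max_ideal_def ideal_def by (cases l) (auto intro: ring_module.span_base)
    then have "var l * v \<in> I" for l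
      unfolding v by (simp add: colon_def)
    then have "v \<in> I"
      by (rule mem_I_of_var_mults)
    then have "f * v \<in> I" for f
      unfolding I ideal_def by (rule ring_module.span_scale)
    with proper show False
      by (auto simp: colon_def)
  qed
  ultimately show ?thesis
    by simp
qed

end
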